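(* Let $T>0$, $e\in\mathbb R$ and $N\ge 0$. The modified matrix $\overline D^N=D_{11}^N+(A_{11}^N)^{-1}A_{12}^N D_{21}^N$ can be written as $$\overline D^N=D_{11}^N-e\sqrt{\frac{2(N+1)}{T}}\;Y^N,$$ where $Y^N\in\mathbb R^{(N+1)\times(N+1)}$ is the matrix all of whose columns are zero except the last one, which equals $z^N$: $$Y^N=\left(\,0\,|\,0\,|\,\cdots\,|\,0\,|\,z^N\right),\qquad z^N\in\mathbb R^{N+1}.$$ Moreover, for $N=2M$ even ($M\ge1$), the first and the third lines of $Y^N$ (indices $0$ and $2$) vanish. For $N=2M+1$ odd ($M\ge 0$), the second line of $Y^N$ (index $1$) vanishes.
   Context: $\mathbb N=\{0,1,2,\dots\}$; rows and columns are indexed from $0$. $H_m$ denotes the (physicists') Hermite polynomial, $H_m(x)=(-1)^m e^{x^2}\frac{d^m}{dx^m}e^{-x^2}$. For fixed $T>0$ the asymmetric Hermite functions are $\psi_m(v)=e^{-v^2/T}T^{-\frac12}(2^m m!\sqrt{\pi})^{-\frac12}H_m(v/\sqrt T)$, and the infinite Gram matrix is $A=(a_{mn})_{m,n\ge0}$, $a_{mn}=\int_{\mathbb R}\psi_m\psi_n\,dv$. The infinite matrix $D=(d_{mn})_{m,n\ge0}$ has $d_{mn}=-e\sqrt{\frac{2m}{T}}\,\delta_{m-1,n}$. For given $N$ the matrices are split in blocks according to the indices $\{0,\dots,N\}$ and $\{N+1,N+2,\dots\}$: $A_{11}^N=(a_{mn})_{0\le m,n\le N}$ (which is invertible), $A_{12}^N=(a_{mn})_{0\le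 m\le N,\;n\ge N+1}$, $D_{11}^N=(d_{mn})_{0\le m,n\le N}$, $D_{21}^N=(d_{mn})_{m\ge N+1,\;0\le n\le N}$. Each column of $D_{21}^N$ has at most one nonzero entry, so the product $A_{12}^ND_{21}^N$ is well defined. The vector $z^N=(z_0^N,\dots,z_N^N)^T$ is the unique solution of $A_{11}^Nz^N=g^N$, where $g^N=(a_{0,N+1},\dots,a_{N,N+1})^T$ is the first column of $A_{12}^N$. *)

theory Defs
  imports "HOL-Analysis.Analysis" "Jordan_Normal_Form.Gauss_Jordan_Elimination"
begin

text \<open>
  Finite matrices and vectors, whose size depends on N, are those of Jordan_Normal_Form
  (0-indexed); infinite matrices are functions on pairs of naturals. The constants
  shared by name with HOL-Analysis are written with the qualifier Matrix.
\<close>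

definition hermite :: "nat \<Rightarrow> real \<Rightarrow> real" where
  "hermite m x = (-1) ^ m * exp (x\<^sup>2) * (deriv ^^ m) (\<lambda>t. exp (- (t\<^sup>2))) x"

definition herm_fun :: "real \<Rightarrow> nat \<Rightarrow> real \<Rightarrow> real" where
  "herm_fun T m v =
     exp (- v\<^sup>2 / T) * T powr (- 1 / 2) * (2 ^ m * fact m * sqrt pi) powr (- 1 / 2)
       * hermite m (v / sqrt T)"

definition gram :: "real \<Rightarrow> nat \<Rightarrow> nat \<Rightarrow> real" where
  "gram T m n = (LINT v|lborel. herm_fun T m v * herm_fun T n v)"

(* The Kronecker delta is written as m = n + 1, since m - 1 truncates on nat. *)
definition dmat :: "real \<Rightarrow> real \<Rightarrow> nat \<Rightarrow> nat \<Rightarrow> real" where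
  "dmat T e m n = - e * sqrt (2 * real m / T) * (if m = n + 1 then 1 else 0)"

definition A11 :: "real \<Rightarrow> nat \<Rightarrow> real mat" where
  "A11 T N = Matrix.mat (N + 1) (N + 1) (\<lambda>(m, n). gram T m n)"

definition D11 :: "real \<Rightarrow> real \<Rightarrow> nat \<Rightarrow> real mat" where
  "D11 T e N = Matrix.mat (N + 1) (N + 1) (\<lambda>(m, n). dmat T e m n)"

(* The product of the infinite blocks A12 (rows up to N, columns from N+1 on) and
   D21 (rows from N+1 on, columns up to N); every entry is a sum with at most one
   nonzero term. *)
definition A12_D21 :: "real \<Rightarrow> real \<Rightarrow> nat \<Rightarrow> real mat" where
  "A12_D21 T e N = Matrix.mat (N + 1) (N + 1)
     (\<lambda>(m, n). \<Sum>\<^sub>\<infinity>k\<in>{N + 1..}. gram T m k * dmat T e k n)"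

(* For T > 0 the matrix A11 T N is invertible, so mat_inverse returns Some inverse. *)
definition Dbar :: "real \<Rightarrow> real \<Rightarrow> nat \<Rightarrow> real mat" where
  "Dbar T e N = D11 T e N + the (mat_inverse (A11 T N)) * A12_D21 T e N"

(* The first column of A12. *)
definition gvec :: "real \<Rightarrow> nat \<Rightarrow> real Matrix.vec" where
  "gvec T N = Matrix.vec (N + 1) (\<lambda>m. gram T m (N + 1))"

definition zvec :: "real \<Rightarrow> nat \<Rightarrow> real Matrix.vec" where
  "zvec T N = (THE z. z \<in> carrier_vec (N + 1) \<and> A11 T N *\<^sub>v z = gvec T N)"

definition Ymat :: "real \<Rightarrow> nat \<Rightarrow> real mat" where
  "Ymat T N = mat_of_cols (N + 1) (replicate N (0\<^sub>v (N + 1)) @ [zvec T N])"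

end

theory Submission
  imports Defs "HOL-Probability.Distributions" "Jordan_Normal_Form.Determinant"
begin

text \<open>
  Only the column of index \<open>N\<close> of \<open>D21\<close> is nonzero, with its single entry in the row of
  index \<open>N + 1\<close>, which gives the formula for the modified matrix. The Gram matrix is
  positive definite because the Hermite functions are linearly independent, and its entries
  with \<open>m + n\<close> odd vanish by parity. Flipping the sign of the entries \<open>z\<^sub>i\<close> with \<open>i + N\<close> even
  therefore gives another solution of the system defining \<open>z\<close>, so these entries vanish.
\<close>

section \<open>Hermite polynomials\<close>

text \<open>Differentiating \<open>p(t) * exp (- t^2)\<close> gives
  \<open>(p' - 2 t p) * exp (- t^2)\<close>; with the sign \<open>(-1)^m\<close> this is the
  recursion. An algebraic polynomial makes degree and coefficients available.\<close>

fun hermite_poly :: "nat \<Rightarrow> real poly" where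
  "hermite_poly 0 = 1"
| "hermite_poly (Suc m) = [:0, 2:] * hermite_poly m - pderiv (hermite_poly m)"

lemma higher_deriv_gaussian:
  "(deriv ^^ m) (\<lambda>t::real. exp (- (t\<^sup>2)))
    = (\<lambda>t. (-1) ^ m * poly (hermite_poly m) t * exp (- (t\<^sup>2)))"
proof (induction m)
  case (Suc m)
  have "((\<lambda>t. (-1) ^ m * poly (hermite_poly m) t * exp (- (t\<^sup>2))) has_field_derivative
      (-1) ^ Suc m * poly (hermite_poly (Suc m)) t * exp (- (t\<^sup>2))) (at t)" for t
    by (auto intro!: derivative_eq_intros simp: algebra_simps)
  then show ?case
    using Suc by (auto intro!: DERIV_imp_deriv)
qed simp

lemma hermite_eq_poly: "hermite m x = poly (hermite_poly m) x"
proof -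
  have "(-1::real) ^ m * (-1) ^ m = 1"
    by (simp flip: power_mult_distrib)
  then show ?thesis
    unfolding hermite_def higher_deriv_gaussian
    by (simp add: exp_minus field_simps)
qed

lemma degree_hermite_poly_le: "degree (hermite_poly m) \<le> m"
proof (induction m)
  case (Suc m)
  have "degree ([:0, 2:] * hermite_poly m) \<le> Suc m"
    using Suc degree_mult_le[of "[:0, 2:]" "hermite_poly m"] by simp
  moreover have "degree (pderiv (hermite_poly m)) \<le> Suc m"
    using Suc by (simp add: degree_pderiv)
  ultimately show ?case
    by (simp add: degree_diff_le)
qed simp

lemma coeff_hermite_poly_self: "poly.coeff (hermite_poly m) m = 2 ^ m"
proof (induction m)
  case (Suc m)
  have "poly.coeff (pderiv (hermite_poly m)) (Suc m) = 0"
    using degree_hermite_poly_le[of m] by (intro coeff_eq_0) (simp add: degree_pderiv)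
  then show ?case
    using Suc by simp
qed simp

text \<open>Multiplication by \<open>2 x\<close> and differentiation both change sign under
  \<open>x -> -x\<close>, so each step of the recursion contributes one factor -1.\<close>

lemma hermite_poly_reflect: "pcompose (hermite_poly m) [:0, -1:] = Polynomial.smult ((-1) ^ m) (hermite_poly m)"
proof (induction m)
  case (Suc m)
  have "pderiv (pcompose (hermite_poly m) [:0, -1:]) = Polynomial.smult ((-1) ^ m) (pderiv (hermite_poly m))"
    unfolding Suc by (rule pderiv_smult)
  \<comment> \<open>The chain rule produces the extra factor -1, the derivative of the inner
    polynomial.\<close>
  then have "pcompose (pderiv (hermite_poly m)) [:0, -1:]
      = - Polynomial.smult ((-1) ^ m) (pderiv (hermite_poly m))"
    by (simp add: pderiv_pcompose pderiv_pCons equation_minus_iff)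
  with Suc show ?case
    by (simp add: pcompose_diff pcompose_mult pcompose_pCons pcompose_smult smult_diff_right mult.commute)
qed (simp add: pcompose_1)

lemma poly_hermite_poly_minus: "poly (hermite_poly m) (- x) = (-1) ^ m * poly (hermite_poly m) x"
  using arg_cong[OF hermite_poly_reflect, of "\<lambda>p. poly p x" m] by (simp add: poly_pcompose)

text \<open>The family is triangular: only the last summand reaches degree \<open>n\<close>, with
  leading coefficient \<open>2 ^ n\<close>, so its coefficient vanishes and induction removes
  it.\<close>

lemma hermite_poly_independent:
  assumes "(\<Sum>i\<le>n. Polynomial.smult (c i) (hermite_poly i)) = 0" "i \<le> n"
  shows "c i = 0"
  using assms
proof (induction n)
  case (Suc n)
  have "poly.coeff (\<Sum>i\<le>n. Polynomial.smult (c i) (hermite_poly i)) (Suc n) = 0"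
    using order_trans[OF degree_hermite_poly_le]
    by (auto simp: coeff_sum intro!: sum.neutral coeff_eq_0 le_imp_less_Suc)
  moreover have "poly.coeff (\<Sum>i\<le>Suc n. Polynomial.smult (c i) (hermite_poly i)) (Suc n) = 0"
    unfolding Suc.prems(1) by simp
  ultimately have "c (Suc n) = 0"
    using coeff_hermite_poly_self[of "Suc n"] by (simp del: hermite_poly.simps)
  with Suc show ?case
    by (auto simp: le_Suc_eq)
qed simp

section \<open>The Gram matrix\<close>

definition herm_const :: "real \<Rightarrow> nat \<Rightarrow> real" where
  "herm_const T m = T powr (- 1 / 2) * (2 ^ m * fact m * sqrt pi) powr (- 1 / 2)"

lemma herm_const_pos: "T > 0 \<Longrightarrow> herm_const T m > 0"
  by (simp add: herm_const_def)

lemma herm_fun_eq: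
  "herm_fun T m v = exp (- v\<^sup>2 / T) * (herm_const T m * poly (hermite_poly m) (v / sqrt T))"
  by (simp add: herm_fun_def herm_const_def hermite_eq_poly)

lemma herm_fun_minus: "herm_fun T m (- v) = (-1) ^ m * herm_fun T m v"
  using poly_hermite_poly_minus[of m "v / sqrt T"] by (simp add: herm_fun_eq)

text \<open>The integrand is odd, so the substitution \<open>v -> -v\<close> shows that the integral
  equals its own negative.\<close>

lemma gram_odd_eq_0:
  assumes "odd (m + n)"
  shows "gram T m n = 0"
proof -
  have "(-1::real) ^ m * (-1) ^ n = -1"
    using assms by (simp flip: power_add)
  then have "herm_fun T m (- v) * herm_fun T n (- v) = - (herm_fun T m v * herm_fun T n v)" for v
    unfolding herm_fun_minus by (metis (no_types) mult.assoc mult.commute mult_minus1)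
  then have "gram T m n = - gram T m n"
    unfolding gram_def by (subst lborel_integral_real_affine[where c = "-1" and t = 0]) simp_all
  then show ?thesis
    by simp
qed

text \<open>The substitution \<open>x = 2 v / sqrt T\<close> turns the weight
  \<open>exp (- 2 v^2 / T)\<close> into \<open>exp (- x^2 / 2)\<close>, which reduces the claim to
  the moments of the standard normal distribution.\<close>

lemma integrable_poly_gaussian:
  assumes "T > 0"
  shows "integrable lborel (\<lambda>v. poly p (v / sqrt T) * exp (- v\<^sup>2 / T) ^ 2)"
proof -
  \<comment> \<open>The argument \<open>v / sqrt T\<close> is \<open>x / 2\<close> in the new
    variable.\<close>
  define q where "q = pcompose p [:0, 1 / 2:]"
  have "integrable lborel (\<lambda>x. \<Sum>k\<le>degree q. poly.coeff q k * sqrt (2 * pi) * (std_normal_density x * x ^ k))"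
    using integrable_normal_moment[of 1 0] by (intro Bochner_Integration.integrable_sum integrable_mult_right) simp
  also have "(\<lambda>x. \<Sum>k\<le>degree q. poly.coeff q k * sqrt (2 * pi) * (std_normal_density x * x ^ k))
      = (\<lambda>x. poly q x * exp (- x\<^sup>2 / 2))"
    by (simp add: fun_eq_iff poly_altdef std_normal_density_def sum_distrib_left mult_ac)
  finally have "integrable lborel (\<lambda>x. poly q x * exp (- x\<^sup>2 / 2))" .
  then have "integrable lborel (\<lambda>v. poly q (0 + 2 / sqrt T * v) * exp (- (0 + 2 / sqrt T * v)\<^sup>2 / 2))"
    using assms by (intro lborel_integrable_real_affine) auto
  moreover have "poly q (0 + 2 / sqrt T * v) * exp (- (0 + 2 / sqrt T * v)\<^sup>2 / 2)
      = poly p (v / sqrt T) * exp (- v\<^sup>2 / T) ^ 2" for v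
    using assms by (simp add: q_def poly_pcompose power_divide power_mult_distrib flip: exp_of_nat_mult)
  ultimately show ?thesis
    by simp
qed

lemma integrable_herm_fun_mult:
  assumes "T > 0"
  shows "integrable lborel (\<lambda>v. herm_fun T m v * herm_fun T n v)"
proof -
  have "herm_fun T m v * herm_fun T n v
    = poly (Polynomial.smult (herm_const T m * herm_const T n) (hermite_poly m * hermite_poly n)) (v / sqrt T)
        * exp (- v\<^sup>2 / T) ^ 2" for v
    by (simp add: herm_fun_eq power2_eq_square)
  then show ?thesis
    using integrable_poly_gaussian[OF assms] by presburger
qed

lemma AE_poly_nonzero:
  fixes p :: "real poly"
  assumes "p \<noteq> 0" "c \<noteq> 0"
  shows "AE v in lborel. poly p (v / c) \<noteq> 0"
proof -
  have "finite {v. poly p (v / c) = 0}"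
    using finite_vimageI[OF poly_roots_finite[OF assms(1)], of "\<lambda>v. v / c"] assms(2)
    by (simp add: vimage_def inj_on_def)
  then have "{v. poly p (v / c) = 0} \<in> null_sets lborel"
    by (rule finite_imp_null_set_lborel)
  then show ?thesis
    using AE_not_in[of _ lborel] by fastforce
qed

text \<open>Integrability of the products allows expanding the square under the integral; the
  quadratic form of the Gram matrix is thus a squared L2 norm.\<close>

lemma gram_quadratic_form:
  assumes "T > 0"
  shows "(\<Sum>m\<le>N. c m * (\<Sum>n\<le>N. gram T m n * c n)) = (LINT v|lborel. (\<Sum>m\<le>N. c m * herm_fun T m v)\<^sup>2)"
proof -
  have "(\<lambda>v. (\<Sum>m\<le>N. c m * herm_fun T m v)\<^sup>2)
      = (\<lambda>v. \<Sum>m\<le>N. \<Sum>n\<le>N. c m * c n * (herm_fun T m v * herm_fun T n v))"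
    by (simp add: fun_eq_iff power2_eq_square sum_product algebra_simps)
  moreover have "(LINT v|lborel. (\<Sum>m\<le>N. \<Sum>n\<le>N. c m * c n * (herm_fun T m v * herm_fun T n v)))
      = (\<Sum>m\<le>N. \<Sum>n\<le>N. c m * c n * gram T m n)"
    using integrable_herm_fun_mult[OF assms] by (simp add: gram_def)
  ultimately show ?thesis
    by (simp add: sum_distrib_left algebra_simps)
qed

text \<open>A kernel vector gives a combination of Hermite functions with L2 norm 0. Dividing by the
  Gaussian leaves a polynomial that vanishes almost everywhere, hence is 0, and independence
  applies.\<close>

lemma gram_kernel_trivial:
  assumes "T > 0" and ker: "\<And>m. m \<le> N \<Longrightarrow> (\<Sum>n\<le>N. gram T m n * c n) = 0" and "i \<le> N"
  shows "c i = 0"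
proof -
  let ?f = "\<lambda>v. \<Sum>m\<le>N. c m * herm_fun T m v"
  define p where "p = (\<Sum>m\<le>N. Polynomial.smult (c m * herm_const T m) (hermite_poly m))"
  have f: "?f v = exp (- v\<^sup>2 / T) * poly p (v / sqrt T)" for v
    by (simp add: p_def herm_fun_eq poly_sum sum_distrib_left algebra_simps)
  have "integrable lborel (\<lambda>v. (?f v)\<^sup>2)"
    using integrable_poly_gaussian[OF assms(1), of "p * p"]
    unfolding f by (simp add: power2_eq_square algebra_simps)
  moreover have "(LINT v|lborel. (?f v)\<^sup>2) = 0"
    using gram_quadratic_form[OF assms(1), of c N] ker by simp
  ultimately have "AE v in lborel. (?f v)\<^sup>2 = 0"
    by (subst (asm) integral_nonneg_eq_0_iff_AE) auto
  then have ae: "AE v in lborel. poly p (v / sqrt T) = 0"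
    unfolding f by simp
  have "p = 0"
  proof (rule ccontr)
    assume "p \<noteq> 0"
    then have "AE v in lborel. poly p (v / sqrt T) \<noteq> 0"
      using assms(1) by (intro AE_poly_nonzero) auto
    \<comment> \<open>This is absurd because the real line is not a null set.\<close>
    with ae have "AE v::real in lborel. False"
      by eventually_elim simp
    then show False
      by (simp add: eventually_False ae_filter_eq_bot_iff)
  qed
  then show ?thesis
    using hermite_poly_independent[of "\<lambda>m. c m * herm_const T m" N i] herm_const_pos[OF assms(1), of i]
      assms(3) by (simp add: p_def)
qed

section \<open>Invertibility of the truncated Gram matrix\<close>

lemma A11_carrier: "A11 T N \<in> carrier_mat (N + 1) (N + 1)"
  by (simp add: A11_def)

lemma A11_mult_vec_index:
  assumes "z \<in> carrier_vec (N + 1)" "m \<le> N"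
  shows "(A11 T N *\<^sub>v z) $ m = (\<Sum>n\<le>N. gram T m n * z $ n)"
  using assms by (simp add: A11_def scalar_prod_def atLeast0LessThan lessThan_Suc_atMost)

text \<open>A trivial kernel gives a nonzero determinant and hence an inverse; this justifies the
  use of \<open>the\<close> in \<open>Dbar\<close>.\<close>

lemma mat_inverse_A11:
  assumes "T > 0"
  obtains B where "mat_inverse (A11 T N) = Some B" "B \<in> carrier_mat (N + 1) (N + 1)"
    "A11 T N * B = 1\<^sub>m (N + 1)" "B * A11 T N = 1\<^sub>m (N + 1)"
proof -
  have "v = 0\<^sub>v (N + 1)" if v: "v \<in> carrier_vec (N + 1)" "A11 T N *\<^sub>v v = 0\<^sub>v (N + 1)" for v
  proof (rule eq_vecI)
    fix i assume "i < dim_vec (0\<^sub>v (N + 1) :: real Matrix.vec)"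
    moreover have "(\<Sum>n\<le>N. gram T m n * v $ n) = 0" if "m \<le> N" for m
      using A11_mult_vec_index[OF v(1) that, of T] v(2) that by simp
    ultimately show "v $ i = 0\<^sub>v (N + 1) $ i"
      using gram_kernel_trivial[OF assms, of N "\<lambda>n. v $ n" i] by simp
  qed (use v in simp)
  then have "Determinant.det (A11 T N) \<noteq> 0"
    using det_0_iff_vec_prod_zero_field[OF A11_carrier, of T N] by blast
  then have "mat_inverse (A11 T N) \<noteq> None"
    using det_non_zero_imp_unit[OF A11_carrier, of T N] mat_inverse(1)[OF A11_carrier, of T N]
    by metis
  then obtain B where "mat_inverse (A11 T N) = Some B"
    by blast
  then show ?thesis
    using mat_inverse(2)[OF A11_carrier, of T N B] that[of B] by simp
qed

section \<open>The linear system for \<open>z\<close> and the parity of its solution\<close>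

lemma zvec_unique:
  assumes "T > 0" "z \<in> carrier_vec (N + 1)" "A11 T N *\<^sub>v z = gvec T N"
  shows "zvec T N = z"
proof -
  obtain B where B: "B \<in> carrier_mat (N + 1) (N + 1)" "B * A11 T N = 1\<^sub>m (N + 1)"
    using mat_inverse_A11[OF assms(1)] by blast
  have "w = B *\<^sub>v gvec T N" if "w \<in> carrier_vec (N + 1)" "A11 T N *\<^sub>v w = gvec T N" for w
    using that assoc_mult_mat_vec[OF B(1) A11_carrier that(1), of T] B(2) by simp
  with assms(2,3) show ?thesis
    unfolding zvec_def by (intro the_equality) metis+
qed

lemma zvec_solves:
  assumes "T > 0" "mat_inverse (A11 T N) = Some B"
  shows "zvec T N = B *\<^sub>v gvec T N" "zvec T N \<in> carrier_vec (N + 1)"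
    "A11 T N *\<^sub>v zvec T N = gvec T N"
proof -
  have g: "gvec T N \<in> carrier_vec (N + 1)"
    by (simp add: gvec_def)
  have B: "B \<in> carrier_mat (N + 1) (N + 1)" "A11 T N * B = 1\<^sub>m (N + 1)"
    using mat_inverse(2)[OF A11_carrier assms(2)] by auto
  have Bg: "B *\<^sub>v gvec T N \<in> carrier_vec (N + 1)" "A11 T N *\<^sub>v (B *\<^sub>v gvec T N) = gvec T N"
    using assoc_mult_mat_vec[OF A11_carrier B(1) g, of T] B g by auto
  show "zvec T N = B *\<^sub>v gvec T N"
    by (rule zvec_unique[OF assms(1) Bg])
  with Bg show "zvec T N \<in> carrier_vec (N + 1)" "A11 T N *\<^sub>v zvec T N = gvec T N"
    by simp_all
qed

lemma zvec_parity:
  assumes "T > 0" "i \<le> N" "even (i + N)"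
  shows "zvec T N $ i = 0"
proof -
  obtain B where B: "mat_inverse (A11 T N) = Some B"
    using mat_inverse_A11[OF assms(1)] by blast
  note z = zvec_solves[OF assms(1) B]
  \<comment> \<open>The sign is -1 exactly when \<open>i + N\<close> is even; entries with the
    parity of \<open>N + 1\<close> are kept.\<close>
  define w where "w = Matrix.vec (N + 1) (\<lambda>i. (-1) ^ (i + N + 1) * zvec T N $ i)"
  have w: "w \<in> carrier_vec (N + 1)"
    by (simp add: w_def)
  have "A11 T N *\<^sub>v w = gvec T N"
  proof (rule eq_vecI)
    fix m assume "m < dim_vec (gvec T N)"
    then have m: "m \<le> N"
      by (simp add: gvec_def)
    \<comment> \<open>For \<open>m + n\<close> odd both sides are 0, otherwise the two signs agree:
      the sign change commutes with the Gram matrix.\<close>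
    have sign: "gram T m n * (-1) ^ (n + N + 1) = (-1) ^ (m + N + 1) * gram T m n" for n
      using gram_odd_eq_0[of m n T] by (cases "even (m + n)") (auto simp: minus_one_power_iff)
    have "(A11 T N *\<^sub>v w) $ m = (\<Sum>n\<le>N. (gram T m n * (-1) ^ (n + N + 1)) * zvec T N $ n)"
      unfolding A11_mult_vec_index[OF w m] by (intro sum.cong) (simp_all add: w_def)
    also have "\<dots> = (-1) ^ (m + N + 1) * (A11 T N *\<^sub>v zvec T N) $ m"
      unfolding sign A11_mult_vec_index[OF z(2) m] by (simp only: sum_distrib_left mult.assoc)
    also have "\<dots> = (-1) ^ (m + N + 1) * gram T m (N + 1)"
      using m by (simp add: z(3) gvec_def)
    \<comment> \<open>The sign change also fixes the right-hand side, whose entries vanish wherever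
      the sign is -1.\<close>
    also have "\<dots> = gram T m (N + 1)"
      using gram_odd_eq_0[of m "N + 1" T] by (cases "even (m + (N + 1))") (auto simp: minus_one_power_iff)
    finally show "(A11 T N *\<^sub>v w) $ m = gvec T N $ m"
      using m by (simp add: gvec_def)
  qed (simp add: A11_def gvec_def)
  then have "zvec T N $ i = w $ i"
    using zvec_unique[OF assms(1) w] by simp
  then show ?thesis
    using assms(2,3) by (simp add: w_def)
qed

section \<open>The modified matrix\<close>

lemma A12_D21_index:
  assumes "m \<le> N" "n \<le> N"
  shows "A12_D21 T e N $$ (m, n)
    = (if n = N then - (e * sqrt (2 * real (N + 1) / T)) * gram T m (N + 1) else 0)"
proof -
  have "A12_D21 T e N $$ (m, n) = (\<Sum>\<^sub>\<infinity>k\<in>{N + 1..}. gram T m k * dmat T e k n)"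
    using assms by (simp add: A12_D21_def)
  \<comment> \<open>A nonzero term needs \<open>k = n + 1\<close>; with \<open>n \<le> N\<close> and
    \<open>k \<ge> N + 1\<close> this forces \<open>k = N + 1\<close> and
    \<open>n = N\<close>.\<close>
  also have "\<dots> = (\<Sum>\<^sub>\<infinity>k\<in>{N + 1}. gram T m k * dmat T e k n)"
    using assms(2) by (intro infsum_cong_neutral) (auto simp: dmat_def)
  finally show ?thesis
    by (simp add: dmat_def)
qed

lemma Ymat_index:
  assumes "i \<le> N" "j \<le> N"
  shows "Ymat T N $$ (i, j) = (if j = N then zvec T N $ i else 0)"
  using assms by (auto simp: Ymat_def mat_of_cols_index nth_append)

lemma Ymat_carrier: "Ymat T N \<in> carrier_mat (N + 1) (N + 1)"
  using mat_of_cols_carrier(1)[of "N + 1" "replicate N (0\<^sub>v (N + 1)) @ [zvec T N]"]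
  by (simp add: Ymat_def)

text \<open>The last column of \<open>A12_D21\<close> is a multiple of \<open>gvec\<close> and the
  others are 0; applying the inverse turns \<open>gvec\<close> into \<open>zvec\<close>.\<close>

lemma inverse_A11_mult_A12_D21:
  assumes "T > 0" "mat_inverse (A11 T N) = Some B"
  shows "B * A12_D21 T e N = - ((e * sqrt (2 * real (N + 1) / T)) \<cdot>\<^sub>m Ymat T N)"
proof (rule eq_matI)
  have B: "B \<in> carrier_mat (N + 1) (N + 1)"
    using mat_inverse(2)[OF A11_carrier assms(2)] by auto
  have M: "A12_D21 T e N \<in> carrier_mat (N + 1) (N + 1)"
    by (simp add: A12_D21_def)
  let ?Y = "- ((e * sqrt (2 * real (N + 1) / T)) \<cdot>\<^sub>m Ymat T N)"
  show "dim_row (B * A12_D21 T e N) = dim_row ?Y" "dim_col (B * A12_D21 T e N) = dim_col ?Y"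
    using B M Ymat_carrier[of T N] by auto
  fix i j assume "i < dim_row ?Y" "j < dim_col ?Y"
  then have ij: "i \<le> N" "j \<le> N"
    using Ymat_carrier[of T N] by auto
  have "(B * A12_D21 T e N) $$ (i, j) = (\<Sum>k\<le>N. B $$ (i, k) * A12_D21 T e N $$ (k, j))"
    using B M ij by (simp add: scalar_prod_def atLeast0LessThan lessThan_Suc_atMost)
  also have "\<dots> = (if j = N then - (e * sqrt (2 * real (N + 1) / T)) *
      (\<Sum>k\<le>N. B $$ (i, k) * gram T k (N + 1)) else 0)"
    using ij by (simp add: A12_D21_index sum_distrib_left sum_negf mult_ac)
  also have "(\<Sum>k\<le>N. B $$ (i, k) * gram T k (N + 1)) = zvec T N $ i"
    using B ij by (simp add: zvec_solves(1)[OF assms] gvec_def scalar_prod_def atLeast0LessThan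
        lessThan_Suc_atMost)
  finally show "(B * A12_D21 T e N) $$ (i, j) = ?Y $$ (i, j)"
    using ij Ymat_carrier[of T N] by (simp add: Ymat_index)
qed

lemma Ymat_row_eq_0:
  assumes "T > 0" "i \<le> N" "even (i + N)"
  shows "Matrix.row (Ymat T N) i = 0\<^sub>v (N + 1)"
proof (rule eq_vecI)
  fix j assume "j < dim_vec (0\<^sub>v (N + 1) :: real Matrix.vec)"
  then show "Matrix.row (Ymat T N) i $ j = 0\<^sub>v (N + 1) $ j"
    using assms(2) Ymat_carrier[of T N] zvec_parity[OF assms] by (simp add: Ymat_index)
qed (use Ymat_carrier[of T N] in simp)

theorem theorem5p8:
  fixes T e :: real and N :: nat
  assumes "T > 0"
  shows "Dbar T e N = D11 T e N - (e * sqrt (2 * real (N + 1) / T)) \<cdot>\<^sub>m Ymat T N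
    \<and> (\<forall>M\<ge>1. N = 2 * M \<longrightarrow>
          Matrix.row (Ymat T N) 0 = 0\<^sub>v (N + 1) \<and> Matrix.row (Ymat T N) 2 = 0\<^sub>v (N + 1))
    \<and> (\<forall>M. N = 2 * M + 1 \<longrightarrow> Matrix.row (Ymat T N) 1 = 0\<^sub>v (N + 1))"
proof (intro conjI)
  obtain B where B: "mat_inverse (A11 T N) = Some B"
    using mat_inverse_A11[OF assms] by blast
  have "D11 T e N \<in> carrier_mat (N + 1) (N + 1)"
    by (simp add: D11_def)
  then show "Dbar T e N = D11 T e N - (e * sqrt (2 * real (N + 1) / T)) \<cdot>\<^sub>m Ymat T N"
    using Ymat_carrier[of T N] unfolding Dbar_def B option.sel inverse_A11_mult_A12_D21[OF assms B]
    by (intro add_uminus_minus_mat) auto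
\<comment> \<open>Rows 0 and 2 have the parity of an even \<open>N\<close>, row 1 that of an odd
  \<open>N\<close>; \<open>M \<ge> 1\<close> ensures that row 2 exists.\<close>
qed (use Ymat_row_eq_0[OF assms] in auto)

end
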